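(* For all $s,j>0$ with $s+j<2$, the metric $|z|^{-s}|z-1|^{-j}|dz|^2$ (in the coordinate $z$ of $\mathbb C$) is a fundamental metric on $\mathbb C\setminus\{0,1\}$; that is, there exists a family $(E_q)_{q\in\mathbb C\setminus\{0,1\}}$ of Evans-Selberg potentials on $\mathbb C\setminus\{0,1\}$, with $E_q$ having pole $q$, whose associated fundamental metric is $|z|^{-s}|z-1|^{-j}|dz|^2$.
   Context: Let $\Sigma$ be an open Riemann surface and $q\in\Sigma$. An Evans-Selberg potential on $\Sigma$ with pole $q$ is a real-valued function $E_q(p)$ such that: (i) $E_q(p)$ is harmonic in $p$ on $\Sigma\setminus\{q\}$; (ii) $E_q(p)-\log|\varphi(p)-\varphi(q)|$ is bounded near $q$, where $\varphi$ is a local coordinate; (iii) $E_q(p)\to+\infty$ as $p\to a_\infty$, the Alexandroff ideal boundary point of $\Sigma$ (i.e. the point at infinity of the one-point compactification of $\Sigma$). An open Riemann surface is potential-theoretically parabolic if it carries no Green function, equivalently no non-constant subharmonic function bounded from above; $\mathbb C\setminus\{0,1\}$ is such a surface. On a potential-theoretically parabolic Riemann surface $\Sigma$, given Evans-Selberg potentials $E_q$ with pole $q$ for $q\in\Sigma$, the (associated) fundamental metric in the local coordinate $z=\varphi(p)$ is $$c(z)|dz|^2:=\exp\Big(\lim_{q\to p}\big(E_q(p)-\log|\varphi(p)-\varphi(q)|\big)\Big)|dz|^2 .$$ On $\mathbb C\setminus\{0,1\}$ the coordinate $\varphi$ is the identity. *)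

theory Defs
  imports "HOL-Analysis.Analysis"
begin

text \<open>The surfaces considered here are plane domains (open connected \<^term>\<open>S :: complex set\<close>),
  with the identity as coordinate. Real functions on \<^term>\<open>S\<close> are total functions on
  \<^typ>\<open>complex\<close> whose values off \<^term>\<open>S\<close>, or at a pole, play no role.\<close>

text \<open>For open \<^term>\<open>S\<close>: \<^term>\<open>u\<close> is of class $C^2$ on \<^term>\<open>S\<close>, and its Laplacian vanishes there.\<close>

definition harmonic_on :: "(complex \<Rightarrow> real) \<Rightarrow> complex set \<Rightarrow> bool" where
  "harmonic_on u S \<longleftrightarrow>
     (\<exists>ux uy uxx uxy uyx uyy :: complex \<Rightarrow> real.
        (\<forall>z\<in>S.
           (u has_derivative (\<lambda>h. ux z * Re h + uy z * Im h)) (at z) \<and>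
           (ux has_derivative (\<lambda>h. uxx z * Re h + uxy z * Im h)) (at z) \<and>
           (uy has_derivative (\<lambda>h. uyx z * Re h + uyy z * Im h)) (at z)) \<and>
        continuous_on S uxx \<and> continuous_on S uxy \<and>
        continuous_on S uyx \<and> continuous_on S uyy \<and>
        (\<forall>z\<in>S. uxx z + uyy z = 0))"

text \<open>The filter of punctured neighbourhoods of the point at infinity \<^term>\<open>None\<close> in the
  one-point compactification of \<^term>\<open>S\<close>, transported back to points of \<^term>\<open>S\<close>.\<close>

definition at_ideal_boundary :: "complex set \<Rightarrow> complex filter" where
  "at_ideal_boundary S =
     filtermap the (atin (Alexandroff_compactification (top_of_set S)) None)"

definition evans_selberg_potential ::
    "complex set \<Rightarrow> complex \<Rightarrow> (complex \<Rightarrow> real) \<Rightarrow> bool" where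
  "evans_selberg_potential S q E \<longleftrightarrow>
     q \<in> S \<and>
     harmonic_on E (S - {q}) \<and>
     (\<exists>B. \<forall>\<^sub>F p in at q. \<bar>E p - ln (cmod (p - q))\<bar> \<le> B) \<and>
     filterlim E at_top (at_ideal_boundary S)"

text \<open>\<^term>\<open>c\<close> is the density, with respect to $|dz|^2$, of the fundamental metric associated with
  the family \<^term>\<open>E\<close>. In the limit the pole \<^term>\<open>q\<close> moves and the point \<^term>\<open>p\<close> is fixed;
  the limit is required to exist. Parabolicity of \<^term>\<open>S\<close> is not part of the definition.\<close>

definition fundamental_metric_of ::
    "complex set \<Rightarrow> (complex \<Rightarrow> complex \<Rightarrow> real) \<Rightarrow> (complex \<Rightarrow> real) \<Rightarrow> bool" where
  "fundamental_metric_of S E c \<longleftrightarrow>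
     (\<forall>p\<in>S. \<exists>L. ((\<lambda>q. E q p - ln (cmod (p - q))) \<longlongrightarrow> L) (at p) \<and> c p = exp L)"

end

theory Submission
  imports Defs
begin

text \<open>Take
  \[ E_q(p) = \log|p-q| - \tfrac{s}{2}(\log|p| + \log|q|) - \tfrac{j}{2}(\log|p-1| + \log|q-1|). \]
  Away from the pole this is locally the real part of a holomorphic function, hence harmonic. The
  ideal boundary of $\mathbf{C}\setminus\{0,1\}$ consists of the three ends $0$, $1$ and $\infty$.
  At $0$ and $1$ the potential grows since $s, j > 0$; at $\infty$ it grows like
  $(1 - s/2 - j/2)\log|p|$, which is where $s + j < 2$ enters. The constant of $E_q$ is chosen so
  that the two-point function is symmetric in $p$ and $q$: on the diagonal the regular part is
  $-s\log|p| - j\log|p-1|$, which doubles the exponents $s/2$ and $j/2$.\<close>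

text \<open>On open \<^term>\<open>S\<close>, a real function whose differential is $\mathrm{Re}(f\,dz)$ with $f$
  holomorphic is locally the real part of a primitive of $f$. The partial derivatives are read off
  from \<^term>\<open>f\<close> and \<^term>\<open>f'\<close>, without constructing that primitive.\<close>

lemma harmonic_on_if_differential_Re_holomorphic:
  assumes u: "\<And>z. z \<in> S \<Longrightarrow> (u has_derivative (\<lambda>h. Re (f z * h))) (at z)"
    and f: "\<And>z. z \<in> S \<Longrightarrow> (f has_field_derivative f' z) (at z)"
    and f': "continuous_on S f'"
  shows "harmonic_on u S"
proof -
  have Re_f: "((\<lambda>z. Re (f z)) has_derivative (\<lambda>h. Re (f' z) * Re h - Im (f' z) * Im h)) (at z)"
    and Im_f: "((\<lambda>z. - Im (f z)) has_derivative (\<lambda>h. - Im (f' z) * Re h - Re (f' z) * Im h)) (at z)"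
    if "z \<in> S" for z
  proof -
    have D: "(f has_derivative (\<lambda>h. f' z * h)) (at z)"
      using f[OF that] by (simp add: has_field_derivative_def)
    show "((\<lambda>z. Re (f z)) has_derivative (\<lambda>h. Re (f' z) * Re h - Im (f' z) * Im h)) (at z)"
      using has_derivative_Re[OF D] by simp
    show "((\<lambda>z. - Im (f z)) has_derivative (\<lambda>h. - Im (f' z) * Re h - Re (f' z) * Im h)) (at z)"
      using has_derivative_minus[OF has_derivative_Im[OF D]]
      by (simp add: mult.commute)
  qed
  show ?thesis
    unfolding harmonic_on_def
    by (rule exI[of _ "\<lambda>z. Re (f z)"], rule exI[of _ "\<lambda>z. - Im (f z)"],
        rule exI[of _ "\<lambda>z. Re (f' z)"], rule exI[of _ "\<lambda>z. - Im (f' z)"],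
        rule exI[of _ "\<lambda>z. - Im (f' z)"], rule exI[of _ "\<lambda>z. - Re (f' z)"])
      (use u Re_f Im_f in \<open>auto intro!: continuous_intros f'\<close>)
qed

lemma has_derivative_ln_cmod:
  assumes "z \<noteq> a"
  shows "((\<lambda>z. ln (cmod (z - a))) has_derivative (\<lambda>h. Re (1 / (z - a) * h))) (at z)"
proof -
  have inner_eq: "inner h (sgn w) * inverse (cmod w) = Re (1 / w * h)" if "w \<noteq> 0" for h w :: complex
    using that
    by (simp add: sgn_div_norm inner_complex_def Re_divide cmod_power2 field_simps
        flip: power2_eq_square)
  have "((\<lambda>z. cmod (z - a)) has_derivative (\<lambda>h. inner h (sgn (z - a)))) (at z)"
    by (rule has_derivative_compose[where g = cmod and f = "\<lambda>z. z - a", simplified,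
          OF _ has_derivative_norm])
      (use assms in \<open>auto intro!: derivative_eq_intros\<close>)
  from has_derivative_ln[OF _ this] assms show ?thesis
    by (simp only: inner_eq right_minus_eq zero_less_norm_iff not_False_eq_True simp_thms)
qed

text \<open>The complement of \<^term>\<open>A\<close> can only be left through a point of \<^term>\<open>A\<close> or through infinity:
  deleting from a large disc small neighbourhoods of the points of \<^term>\<open>A\<close> leaves a compact set.\<close>

lemma at_ideal_boundary_Compl_le:
  "at_ideal_boundary (- A) \<le> sup at_infinity (SUP a\<in>A. at a)"
proof (rule filter_leI)
  fix P assume "eventually P (sup at_infinity (SUP a\<in>A. at a :: complex filter))"
  then have inf: "eventually P at_infinity" and pts: "\<And>a. a \<in> A \<Longrightarrow> eventually P (at a)"
    by (auto simp: eventually_sup eventually_Sup)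
  obtain R where R: "\<And>z. R \<le> cmod z \<Longrightarrow> P z"
    using inf by (auto simp: eventually_at_infinity)
  have "\<forall>a\<in>A. \<exists>V. open V \<and> a \<in> V \<and> (\<forall>z\<in>V. z \<noteq> a \<longrightarrow> P z)"
    using pts by (auto simp: eventually_at_topological)
  then obtain V where V: "\<And>a. a \<in> A \<Longrightarrow> open (V a) \<and> a \<in> V a \<and> (\<forall>z\<in>V a. z \<noteq> a \<longrightarrow> P z)"
    by metis
  define C where "C = cball 0 R - (\<Union>a\<in>A. V a)"
  have "open (\<Union>a\<in>A. V a)"
    using V by auto
  then have "compact C"
    unfolding C_def by (intro compact_diff compact_cball)
  have "C \<subseteq> - A"
    using V unfolding C_def by auto
  have comp: "compactin (top_of_set (- A)) C"
    using \<open>compact C\<close> \<open>C \<subseteq> - A\<close> by (simp add: compactin_subtopology)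
  have clos: "closedin (top_of_set (- A)) C"
    using \<open>compact C\<close> \<open>C \<subseteq> - A\<close> by (intro closed_subset compact_imp_closed)
  have P: "P z" if z: "z \<in> - A - C" for z
  proof (cases "R \<le> cmod z")
    case False
    then obtain a where "a \<in> A" "z \<in> V a"
      using z unfolding C_def by auto
    moreover from this z have "z \<noteq> a"
      by auto
    ultimately show ?thesis
      using V by blast
  qed (use R in auto)
  have "openin (Alexandroff_compactification (top_of_set (- A)))
          (insert None (Some ` (- A - C)))"
    using comp clos by (auto simp: openin_Alexandroff_compactification)
  then show "eventually P (at_ideal_boundary (- A))"
    unfolding at_ideal_boundary_def eventually_filtermap eventually_atin
    using P by (intro disjI2 exI[of _ "insert None (Some ` (- A - C))"]) auto
qed

lemma filterlim_ln_cmod_at_bot: "filterlim (\<lambda>z. ln (cmod (z - a))) at_bot (at a)"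
proof (rule filterlim_compose[OF ln_at_0])
  have "((\<lambda>z. cmod (z - a)) \<longlongrightarrow> cmod (a - a)) (at a)"
    by (intro tendsto_intros)
  then show "filterlim (\<lambda>z. cmod (z - a)) (at_right 0) (at a)"
    by (auto simp: filterlim_at eventually_at_filter)
qed

lemma ln_cmod_diff_minus_ln_cmod_tendsto_0:
  "((\<lambda>z. ln (cmod (z - a)) - ln (cmod z)) \<longlongrightarrow> 0) at_infinity"
proof -
  have "((\<lambda>z. ln (cmod (1 - a * inverse z))) \<longlongrightarrow> ln (cmod (1 - a * 0))) at_infinity"
    by (intro tendsto_intros tendsto_inverse_0) auto
  moreover have "\<forall>\<^sub>F z in at_infinity. ln (cmod (1 - a * inverse z)) = ln (cmod (z - a)) - ln (cmod z)"
  proof (rule eventually_at_infinityI)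
    fix z assume z: "cmod a + 1 \<le> cmod z"
    then have "z \<noteq> 0" "z \<noteq> a"
      using norm_ge_zero[of a] by (auto simp del: norm_ge_zero)
    moreover have "1 - a * inverse z = (z - a) / z"
      using \<open>z \<noteq> 0\<close> by (simp add: field_simps)
    ultimately show "ln (cmod (1 - a * inverse z)) = ln (cmod (z - a)) - ln (cmod z)"
      by (simp add: norm_divide ln_div)
  qed
  ultimately show ?thesis
    using tendsto_cong by fastforce
qed

text \<open>The potential with pole \<^term>\<open>q\<close>, without its additive constant; \<^term>\<open>a\<close> and \<^term>\<open>b\<close> are the weights of the
  logarithmic poles at 0 and 1.\<close>

definition twice_punctured_potential :: "real \<Rightarrow> real \<Rightarrow> complex \<Rightarrow> complex \<Rightarrow> real" where
  "twice_punctured_potential a b q p =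
     ln (cmod (p - q)) - a * ln (cmod p) - b * ln (cmod (p - 1))"

lemma harmonic_on_twice_punctured_potential:
  "harmonic_on (\<lambda>p. twice_punctured_potential a b q p + k) (- {0, 1} - {q})"
proof (rule harmonic_on_if_differential_Re_holomorphic)
  fix z assume z: "z \<in> - {0, 1} - {q}"
  have 0: "((\<lambda>z. ln (cmod z)) has_derivative (\<lambda>h. Re (1 / z * h))) (at z)"
    using has_derivative_ln_cmod[of z 0] z by simp
  have "((\<lambda>p. twice_punctured_potential a b q p + k) has_derivative
      (\<lambda>h. Re (1 / (z - q) * h) - a * Re (1 / z * h) - b * Re (1 / (z - 1) * h) + 0)) (at z)"
    unfolding twice_punctured_potential_def
    by (intro has_derivative_add has_derivative_diff has_derivative_mult_right has_derivative_const
        has_derivative_ln_cmod 0) (use z in auto)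
  also have "(\<lambda>h. Re (1 / (z - q) * h) - a * Re (1 / z * h) - b * Re (1 / (z - 1) * h) + 0) =
      (\<lambda>h. Re ((1 / (z - q) - of_real a * (1 / z) - of_real b * (1 / (z - 1))) * h))"
    by (simp only: left_diff_distrib minus_complex.sel mult.assoc Re_complex_of_real
        Im_complex_of_real times_complex.sel) simp
  finally show "((\<lambda>p. twice_punctured_potential a b q p + k) has_derivative
      (\<lambda>h. Re ((1 / (z - q) - of_real a * (1 / z) - of_real b * (1 / (z - 1))) * h))) (at z)" .
  show "((\<lambda>z. 1 / (z - q) - of_real a * (1 / z) - of_real b * (1 / (z - 1))) has_field_derivative
      - (1 / (z - q)\<^sup>2) + of_real a * (1 / z\<^sup>2) + of_real b * (1 / (z - 1)\<^sup>2)) (at z)"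
    using z by (auto intro!: derivative_eq_intros simp: power2_eq_square)
qed (auto intro!: continuous_intros)

lemma filterlim_twice_punctured_potential:
  assumes "a > 0" "b > 0" "a + b < 1" "q \<notin> {0, 1}"
  shows "filterlim (twice_punctured_potential a b q) at_top (at_ideal_boundary (- {0, 1}))"
proof -
  let ?E = "twice_punctured_potential a b q"
  have at_0: "filterlim ?E at_top (at 0)"
  proof -
    have "filterlim (\<lambda>p. (ln (cmod (p - q)) - b * ln (cmod (p - 1))) + a * - ln (cmod p)) at_top (at 0)"
    proof (rule filterlim_tendsto_add_at_top)
      show "((\<lambda>p. ln (cmod (p - q)) - b * ln (cmod (p - 1))) \<longlongrightarrow>
          ln (cmod (0 - q)) - b * ln (cmod (0 - 1))) (at 0)"
        by (intro tendsto_intros) (use assms in auto)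
      show "filterlim (\<lambda>p. a * - ln (cmod p)) at_top (at 0)"
        using filterlim_ln_cmod_at_bot[of 0] assms
        by (intro filterlim_tendsto_pos_mult_at_top[OF tendsto_const])
          (auto simp: filterlim_uminus_at_bot)
    qed
    then show ?thesis
      by (simp add: twice_punctured_potential_def[abs_def] algebra_simps)
  qed
  have at_1: "filterlim ?E at_top (at 1)"
  proof -
    have "filterlim (\<lambda>p. (ln (cmod (p - q)) - a * ln (cmod p)) + b * - ln (cmod (p - 1))) at_top (at 1)"
    proof (rule filterlim_tendsto_add_at_top)
      show "((\<lambda>p. ln (cmod (p - q)) - a * ln (cmod p)) \<longlongrightarrow>
          ln (cmod (1 - q)) - a * ln (cmod 1)) (at 1)"
        by (intro tendsto_intros) (use assms in auto)
      show "filterlim (\<lambda>p. b * - ln (cmod (p - 1))) at_top (at 1)"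
        using filterlim_ln_cmod_at_bot[of 1] assms
        by (intro filterlim_tendsto_pos_mult_at_top[OF tendsto_const])
          (auto simp: filterlim_uminus_at_bot)
    qed
    then show ?thesis
      by (simp add: twice_punctured_potential_def[abs_def] algebra_simps)
  qed
  have at_inf: "filterlim ?E at_top at_infinity"
  proof -
    have "filterlim (\<lambda>p. ((ln (cmod (p - q)) - ln (cmod p)) - b * (ln (cmod (p - 1)) - ln (cmod p)))
        + (1 - a - b) * ln (cmod p)) at_top at_infinity"
    proof (rule filterlim_tendsto_add_at_top)
      show "((\<lambda>p. (ln (cmod (p - q)) - ln (cmod p)) - b * (ln (cmod (p - 1)) - ln (cmod p)))
          \<longlongrightarrow> 0 - b * 0) at_infinity"
        by (intro tendsto_diff tendsto_mult tendsto_const ln_cmod_diff_minus_ln_cmod_tendsto_0)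
      show "filterlim (\<lambda>p. (1 - a - b) * ln (cmod p)) at_top at_infinity"
        using assms filterlim_compose[OF ln_at_top filterlim_norm_at_top]
        by (intro filterlim_tendsto_pos_mult_at_top[OF tendsto_const]) auto
    qed
    then show ?thesis
      by (simp add: twice_punctured_potential_def[abs_def] algebra_simps)
  qed
  have "filterlim ?E at_top (sup at_infinity (SUP z\<in>{0, 1}. at z))"
    using at_0 at_1 at_inf by (simp add: filterlim_sup)
  then show ?thesis
    by (rule filterlim_mono[OF _ order_refl at_ideal_boundary_Compl_le])
qed

lemma evans_selberg_twice_punctured_potential:
  assumes "a > 0" "b > 0" "a + b < 1" "q \<notin> {0, 1}"
  shows "evans_selberg_potential (- {0, 1}) q (\<lambda>p. twice_punctured_potential a b q p + k)"
  unfolding evans_selberg_potential_def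
proof (intro conjI)
  show "q \<in> - {0, 1}"
    using assms by simp
  show "harmonic_on (\<lambda>p. twice_punctured_potential a b q p + k) (- {0, 1} - {q})"
    by (rule harmonic_on_twice_punctured_potential)
  show "filterlim (\<lambda>p. twice_punctured_potential a b q p + k) at_top (at_ideal_boundary (- {0, 1}))"
    using filterlim_tendsto_add_at_top[OF tendsto_const filterlim_twice_punctured_potential[OF assms]]
    by (simp add: add.commute)
  let ?L = "k - a * ln (cmod q) - b * ln (cmod (q - 1))"
  have "((\<lambda>p. \<bar>k - a * ln (cmod p) - b * ln (cmod (p - 1))\<bar>) \<longlongrightarrow> \<bar>?L\<bar>) (at q)"
    by (intro tendsto_intros) (use assms in auto)
  then have "\<forall>\<^sub>F p in at q. \<bar>k - a * ln (cmod p) - b * ln (cmod (p - 1))\<bar> < \<bar>?L\<bar> + 1"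
    by (rule order_tendstoD) simp
  then have "\<forall>\<^sub>F p in at q. \<bar>twice_punctured_potential a b q p + k - ln (cmod (p - q))\<bar> \<le> \<bar>?L\<bar> + 1"
    by eventually_elim (simp add: twice_punctured_potential_def algebra_simps)
  then show "\<exists>B. \<forall>\<^sub>F p in at q. \<bar>twice_punctured_potential a b q p + k - ln (cmod (p - q))\<bar> \<le> B"
    by blast
qed

theorem corollary1p6:
  fixes s j :: real
  assumes "s > 0" and "j > 0" and "s + j < 2"
  shows "\<exists>E :: complex \<Rightarrow> complex \<Rightarrow> real.
           (\<forall>q \<in> UNIV - {0, 1}. evans_selberg_potential (UNIV - {0, 1}) q (E q)) \<and>
           fundamental_metric_of (UNIV - {0, 1}) E
             (\<lambda>z. cmod z powr (- s) * cmod (z - 1) powr (- j))"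
proof -
  define k where "k q = - (s/2) * ln (cmod q) - (j/2) * ln (cmod (q - 1))" for q
  define E where "E q p = twice_punctured_potential (s/2) (j/2) q p + k q" for q p
  have "evans_selberg_potential (- {0, 1}) q (E q)" if "q \<notin> {0, 1}" for q
    unfolding E_def using assms that by (intro evans_selberg_twice_punctured_potential) auto
  moreover have "fundamental_metric_of (- {0, 1}) E
      (\<lambda>z. cmod z powr (- s) * cmod (z - 1) powr (- j))"
    unfolding fundamental_metric_of_def
  proof (intro ballI exI conjI)
    fix p :: complex assume p: "p \<in> - {0, 1}"
    have "((\<lambda>q. k p + k q) \<longlongrightarrow> k p + k p) (at p)"
      unfolding k_def by (intro tendsto_intros) (use p in auto)
    then show "((\<lambda>q. E q p - ln (cmod (p - q))) \<longlongrightarrow> k p + k p) (at p)"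
      by (simp add: E_def twice_punctured_potential_def k_def algebra_simps)
    have "k p + k p = - s * ln (cmod p) + - j * ln (cmod (p - 1))"
      by (simp add: k_def)
    then show "cmod p powr (- s) * cmod (p - 1) powr (- j) = exp (k p + k p)"
      using p by (simp only: powr_def exp_add) auto
  qed
  ultimately show ?thesis
    unfolding Compl_eq_Diff_UNIV by blast
qed

end
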